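(* Let $\mathbb{S}\subset\mathbb{N}$ be the multiplicatively closed set generated by finitely many (at least one) integers $n_1,\dots,n_k>1$, i.e. $\mathbb{S}=\{n_1^{t_1}\cdots n_k^{t_k}\mid t_1,\dots,t_k\in\mathbb{N}\cup\{0\}\}$. Then $\mathbb{S}$ has arbitrarily large gaps: for every positive integer $K$ there are two consecutive elements of $\mathbb{S}$ whose difference is at least $K$. *)

theory Defs
  imports Main
begin

definition mult_generated :: "nat \<Rightarrow> (nat \<Rightarrow> nat) \<Rightarrow> nat set" where
  "mult_generated k n = {\<Prod>i=1..k. n i ^ t i | t :: nat \<Rightarrow> nat. True}"

definition consecutive_in :: "nat set \<Rightarrow> nat \<Rightarrow> nat \<Rightarrow> bool" where
  "consecutive_in S a b \<longleftrightarrow> a \<in> S \<and> b \<in> S \<and> a < b \<and> (\<forall>c\<in>S. \<not> (a < c \<and> c < b))"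

end

theory Submission
  imports Defs "HOL.Factorial"
begin

text \<open>
  Let \<open>N = n\<^sub>1 \<cdots> n\<^sub>k\<close> and \<open>x = N \<cdot> K!\<close>. For \<open>1 \<le> j \<le> K\<close> we have \<open>x + j = j (1 + N \<cdot> K!/j)\<close>, and
  the second factor exceeds 1 and is coprime to \<open>N\<close>. Since every generated number divides a power
  of \<open>N\<close>, none of \<open>x + 1, \<dots>, x + K\<close> is generated, so the generated numbers neighbouring this
  block lie more than \<open>K\<close> apart.
\<close>

text \<open>The sum of all exponents bounds each single one, so it serves as a common exponent
  \<open>T\<close> for every factor.\<close>

lemma mult_generated_dvd_power:
  assumes "c \<in> mult_generated k n"
  obtains T where "c dvd (\<Prod>i=1..k. n i) ^ T"
proof -
  obtain t where c: "c = (\<Prod>i=1..k. n i ^ t i)"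
    using assms by (auto simp: mult_generated_def)
  have "c dvd (\<Prod>i=1..k. n i ^ (\<Sum>j=1..k. t j))"
    unfolding c by (intro prod_dvd_prod le_imp_power_dvd member_le_sum) auto
  then show thesis
    using that by (simp add: prod_power_distrib)
qed

lemma not_in_mult_generated_fact_block:
  fixes n :: "nat \<Rightarrow> nat"
  assumes pos: "\<And>i. i \<in> {1..k} \<Longrightarrow> n i > 0" and j: "1 \<le> j" "j \<le> K"
  shows "(\<Prod>i=1..k. n i) * fact K + j \<notin> mult_generated k n"
proof
  define N where "N = (\<Prod>i=1..k. n i)"
  assume "(\<Prod>i=1..k. n i) * fact K + j \<in> mult_generated k n"
  then obtain T where T: "N * fact K + j dvd N ^ T"
    unfolding N_def by (rule mult_generated_dvd_power)
  obtain q where q: "fact K = j * q"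
    using dvd_fact[OF j] by (rule dvdE)
  have "N * fact K + j = j * (N * q + 1)"
    by (simp add: q algebra_simps)
  with T have "N * q + 1 dvd N ^ T"
    by (metis dvd_mult_right)
  \<comment> \<open>Consecutive numbers are coprime; coprimality with \<open>N * q\<close> passes to
    its factor \<open>N\<close> and then to powers of \<open>N\<close>.\<close>
  moreover have "coprime (N * q + 1) (N ^ T)"
  proof -
    have "coprime (N * q + 1) (N * q)"
      by (metis Suc_eq_plus1 coprime_Suc_left_nat)
    then show ?thesis
      by simp
  qed
  ultimately have "is_unit (N * q + 1)"
    by (metis coprime_absorb_left)
  then have "N * q = 0"
    by simp
  moreover have "N \<noteq> 0"
    unfolding N_def using pos by (metis finite_atLeastAtMost not_gr_zero prod_zero_iff)
  moreover have "q \<noteq> 0"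
    using q fact_nonzero[of K] by (metis mult_0_right fact_nonzero)
  ultimately show False
    by simp
qed

text \<open>Take the greatest element up to \<open>x\<close> and the least one beyond
  \<open>x\<close>: any other element lies on one side of \<open>x\<close>, hence not strictly
  between them.\<close>

lemma consecutive_in_around:
  assumes "a0 \<in> S" "a0 \<le> x" "b0 \<in> S" "x < b0"
  obtains a b where "consecutive_in S a b" "a \<le> x" "x < b"
proof
  let ?A = "{a \<in> S. a \<le> x}" and ?P = "\<lambda>b. b \<in> S \<and> x < b"
  have fin: "finite ?A" and "?A \<noteq> {}"
    using assms by auto
  then have A: "Max ?A \<in> ?A"
    by (rule Max_in)
  have B: "?P (Least ?P)"
    using assms by (intro LeastI) auto
  show "Max ?A \<le> x" "x < Least ?P"
    using A B by auto
  have "\<not> (Max ?A < c \<and> c < Least ?P)" if "c \<in> S" for c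
    using Max_ge[OF fin, of c] not_less_Least[of c ?P] that by fastforce
  with A B show "consecutive_in S (Max ?A) (Least ?P)"
    by (auto simp: consecutive_in_def)
qed

lemma one_in_mult_generated: "1 \<in> mult_generated k n"
  unfolding mult_generated_def by (auto intro!: exI[of _ "\<lambda>_. 0"])

lemma power_in_mult_generated:
  assumes "i \<in> {1..k}"
  shows "n i ^ m \<in> mult_generated k n"
proof -
  have "(\<Prod>j=1..k. n j ^ (if j = i then m else 0)) = (\<Prod>j=1..k. if j = i then n j ^ m else 1)"
    by (intro prod.cong) auto
  also have "\<dots> = n i ^ m"
    using assms by simp
  finally have "n i ^ m = (\<Prod>j=1..k. n j ^ (if j = i then m else 0))" ..
  then show ?thesis
    unfolding mult_generated_def by (intro CollectI exI) simp
qed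

theorem theorem8p6:
  fixes k :: nat and n :: "nat \<Rightarrow> nat"
  assumes "k \<ge> 1"
    and "\<And>i. i \<in> {1..k} \<Longrightarrow> n i > 1"
  shows "\<forall>K::nat. K > 0 \<longrightarrow> (\<exists>a b. consecutive_in (mult_generated k n) a b \<and> b - a \<ge> K)"
proof (intro allI impI)
  fix K :: nat
  let ?S = "mult_generated k n"
  define x where "x = (\<Prod>i=1..k. n i) * fact K"
  have pos: "n i > 0" if "i \<in> {1..k}" for i
    using assms(2)[OF that] by simp
  have "x > 0"
    unfolding x_def using pos by (auto intro!: prod_pos)
  then have "1 \<le> x"
    by simp
  \<comment> \<open>As \<open>k \<ge> 1\<close>, there is a generator \<open>n 1 > 1\<close>, whose
    powers provide an element beyond \<open>x\<close>; the element \<open>1\<close> lies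
    below.\<close>
  moreover have "n 1 ^ x \<in> ?S" "x < n 1 ^ x"
    using assms by (auto intro: power_in_mult_generated power_gt_expt)
  ultimately obtain a b where ab: "consecutive_in ?S a b" "a \<le> x" "x < b"
    using one_in_mult_generated consecutive_in_around by metis
  have "x + j \<notin> ?S" if "1 \<le> j" "j \<le> K" for j
    unfolding x_def using not_in_mult_generated_fact_block pos that by blast
  \<comment> \<open>If \<open>b - x \<le> K\<close>, then \<open>b = x + (b - x)\<close> would lie
    in the excluded block; otherwise \<open>a \<le> x\<close> gives
    \<open>b - a > K\<close>.\<close>
  from this[of "b - x"] ab have "b - a \<ge> K"
    by (cases "b - x \<le> K") (auto simp: consecutive_in_def)
  with ab show "\<exists>a b. consecutive_in ?S a b \<and> b - a \<ge> K"
    by blast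
qed

end
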